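(* Let $k\in\,]0,2]$, $M>0$, $\beta\in\,]0,\tfrac12[$, $0<\sigma_0\le\min\{1,\frac{3\beta^3}{4\pi M^2}\}$ and $I=\inf_{g\in\mathcal A}\mathcal D(g)$. Let $f\in\mathcal A$ and $\varepsilon,\eta,R>0$ be such that $\frac{2M}{R}\le1-\frac{1}{(1+\eta)^2}$, $f\le1$, $\mathcal D(f)\le I+\varepsilon$, and $$\Delta M:=\int_{|x|\ge R}\int_{\mathbb R^3}\sqrt{1+|v|^2}f\,dx\,dv\in\,]0,M[.$$ If $f_1=\mathbf 1_{\{|x|\le R\}}f$, then $$\frac{\Delta M}{M-\Delta M}\,|\mathcal D(f_1)|\le(1+\eta)\Delta M+\varepsilon.$$
   Context: Let $\chi(s)=\frac{k}{k+1}s^{1+1/k}$. A measurable $f\ge0$ on $\mathbb R^3\times\mathbb R^3$ is spherically symmetric if $f(Ax,Av)=f(x,v)$ for all $A\in SO(3)$. For such $f$: $\rho_f(x)=\int\sqrt{1+|v|^2}f(x,v)\,dv$ (radial, written $\rho_f(r)$), $m_f(r)=\int_{|x|\le r}\int\sqrt{1+|v|^2}f\,dx\,dv$, $\lambda_f$ given by $e^{-2\lambda_f(r)}=1-2m_f(r)/r$, and $\mathcal D(f)=\int\int e^{\lambda_f(|x|)}(\chi(f)-f)\,dx\,dv$. $\mathcal A$ is the set of measurable spherically symmetric $f\ge0$ with $\int\int\sqrt{1+|v|^2}f\,dx\,dv=M$ and $\rho_f(r)\le\sigma_0$ for all $r\ge0$. *)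

theory Defs
  imports "HOL-Analysis.Analysis"
begin

type_synonym phase = "(real^3) \<times> (real^3)"

text \<open>chi(s) = k/(k+1) s^(1+1/k)\<close>
definition chi :: "real \<Rightarrow> real \<Rightarrow> real" where
  "chi k s = k / (k + 1) * s powr (1 + 1 / k)"

definition spher_symm :: "(phase \<Rightarrow> real) \<Rightarrow> bool" where
  "spher_symm f \<longleftrightarrow>
     (\<forall>A :: real^3^3. orthogonal_matrix A \<and> det A = 1 \<longrightarrow>
        (\<forall>x v. f (A *v x, A *v v) = f (x, v)))"

text \<open>rho_f(x) = int sqrt(1+|v|^2) f(x,v) dv\<close>
definition rho :: "(phase \<Rightarrow> real) \<Rightarrow> real^3 \<Rightarrow> ennreal" where
  "rho f x = (\<integral>\<^sup>+ v. ennreal (sqrt (1 + (norm v)\<^sup>2) * f (x, v)) \<partial>lebesgue)"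

text \<open>total (energy) mass of f over the phase-space region S\<close>
definition mass_on :: "(phase \<Rightarrow> real) \<Rightarrow> phase set \<Rightarrow> ennreal" where
  "mass_on f S = (\<integral>\<^sup>+ z. indicator S z * ennreal (sqrt (1 + (norm (snd z))\<^sup>2) * f z) \<partial>lebesgue)"

text \<open>m_f(r)\<close>
definition m_f :: "(phase \<Rightarrow> real) \<Rightarrow> real \<Rightarrow> real" where
  "m_f f r = enn2real (mass_on f {z. norm (fst z) \<le> r})"

text \<open>lambda_f(r), defined by exp(-2 lambda_f(r)) = 1 - 2 m_f(r)/r\<close>
definition lam :: "(phase \<Rightarrow> real) \<Rightarrow> real \<Rightarrow> real" where
  "lam f r = - ln (1 - 2 * m_f f r / r) / 2"

text \<open>D(f) = int int e^lambda (chi(f) - f), as an extended real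
  (the first part may be +infinity, the second is finite on the class considered)\<close>
definition D :: "real \<Rightarrow> (phase \<Rightarrow> real) \<Rightarrow> ereal" where
  "D k f = enn2ereal (\<integral>\<^sup>+ z. ennreal (exp (lam f (norm (fst z))) * chi k (f z)) \<partial>lebesgue)
         - enn2ereal (\<integral>\<^sup>+ z. ennreal (exp (lam f (norm (fst z))) * f z) \<partial>lebesgue)"

definition admissible :: "real \<Rightarrow> real \<Rightarrow> (phase \<Rightarrow> real) set" where
  "admissible M \<sigma>0 = {f. f \<in> borel_measurable lebesgue \<and> spher_symm f \<and> (\<forall>z. 0 \<le> f z)
      \<and> mass_on f UNIV = ennreal M \<and> (\<forall>x. rho f x \<le> ennreal \<sigma>0)}"

end

theory Submission
  imports Defs
begin

(*
  Cut f off at radius R and dilate the remainder in x by the factor a with a^3 = M / (M - Delta M).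
  The result g is again admissible (mass M, and rho_g(x) = rho_f1(x/a) <= sigma0), so
  -D(g) <= -D(f) + epsilon. Dilating can only increase the compactness 2 m(r)/r, hence the metric
  coefficient e^lambda, so -D(g) >= a^3 (-D(f1)). Outside radius R the bound 2M/R <= 1 - 1/(1+eta)^2
  gives e^lambda_f <= 1 + eta, so -D(f) <= -D(f1) + (1 + eta) Delta M. Combining the three
  inequalities gives (a^3 - 1) |D(f1)| <= (1 + eta) Delta M + epsilon.
*)

section \<open>Lebesgue measure on a product of Euclidean spaces\<close>

lemma
  shows lebesgue_measurable_fst[measurable]:
      "fst \<in> (lebesgue :: ('a::euclidean_space \<times> 'b::euclidean_space) measure) \<rightarrow>\<^sub>M borel"
    and lebesgue_measurable_snd[measurable]:
      "snd \<in> (lebesgue :: ('a::euclidean_space \<times> 'b::euclidean_space) measure) \<rightarrow>\<^sub>M borel"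
  by (auto intro!: measurable_completion borel_measurable_continuous_onI continuous_intros)

lemma
  shows sets_lebesgue_norm_fst_le[measurable]:
      "{z :: 'a::euclidean_space \<times> 'b::euclidean_space. norm (fst z) \<le> r} \<in> sets lebesgue"
    and sets_lebesgue_norm_fst_ge[measurable]:
      "{z :: 'a::euclidean_space \<times> 'b::euclidean_space. r \<le> norm (fst z)} \<in> sets lebesgue"
proof -
  have "Measurable.pred lebesgue (\<lambda>z :: 'a \<times> 'b. norm (fst z) \<le> r)"
    "Measurable.pred lebesgue (\<lambda>z :: 'a \<times> 'b. r \<le> norm (fst z))"
    by measurable measurable
  then show "{z :: 'a \<times> 'b. norm (fst z) \<le> r} \<in> sets lebesgue"
    "{z :: 'a \<times> 'b. r \<le> norm (fst z)} \<in> sets lebesgue"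
    by (simp_all add: pred_def)
qed

lemma nn_integral_lebesgue_pair:
  fixes F :: "'a::euclidean_space \<times> 'b::euclidean_space \<Rightarrow> ennreal"
  assumes "F \<in> borel_measurable lebesgue"
  shows "(\<integral>\<^sup>+z. F z \<partial>lebesgue) = (\<integral>\<^sup>+x. (\<integral>\<^sup>+v. F (x, v) \<partial>lebesgue) \<partial>lebesgue)"
proof -
  obtain G where G: "G \<in> borel_measurable lborel" "AE z in lborel. F z = G z"
    using completion_ex_borel_measurable[OF assms] by blast
  have "AE z in lborel \<Otimes>\<^sub>M lborel. F z = G z"
    unfolding lborel_prod by (rule G(2))
  from lborel_pair.AE_pair[OF this]
  have "(\<integral>\<^sup>+x. \<integral>\<^sup>+v. G (x, v) \<partial>lborel \<partial>lborel) = (\<integral>\<^sup>+x. \<integral>\<^sup>+v. F (x, v) \<partial>lborel \<partial>lborel)"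
    by (intro nn_integral_cong_AE) (auto elim!: eventually_mono intro!: nn_integral_cong_AE)
  moreover have "(\<integral>\<^sup>+z. G z \<partial>lborel) = (\<integral>\<^sup>+x. \<integral>\<^sup>+v. G (x, v) \<partial>lborel \<partial>lborel)"
    using lborel.nn_integral_fst[of G lborel] G(1) by (simp add: lborel_prod)
  moreover have "(\<integral>\<^sup>+z. F z \<partial>lborel) = (\<integral>\<^sup>+z. G z \<partial>lborel)"
    using G(2) by (rule nn_integral_cong_AE)
  ultimately show ?thesis by (simp add: nn_integral_completion)
qed

lemma null_sets_lebesgue_norm_fst_eq:
  "{z :: 'a::euclidean_space \<times> 'b::euclidean_space. norm (fst z) = r} \<in> null_sets lebesgue"
proof -
  have "sphere (0::'a) r \<in> null_sets lborel"
    using negligible_sphere by (auto simp: negligible_iff_null_sets null_sets_completion_iff)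
  then have "sphere (0::'a) r \<times> (UNIV :: 'b set) \<in> null_sets (lborel \<Otimes>\<^sub>M lborel)"
    by (auto simp: null_sets_def lborel.emeasure_pair_measure_Times)
  moreover have "{z :: 'a \<times> 'b. norm (fst z) = r} = sphere 0 r \<times> UNIV" by auto
  ultimately show ?thesis by (simp add: lborel_prod null_sets_completionI)
qed

text \<open>Scaling the first factor is a diagonal affine map, so \<open>lebesgue_affine_euclidean\<close> applies.\<close>

lemma apfst_scaleR_eq_sum:
  fixes z :: "'a::euclidean_space \<times> 'b::euclidean_space"
  shows "apfst ((*\<^sub>R) c) z = (\<Sum>j\<in>Basis. ((if snd j = 0 then c else 1) * (z \<bullet> j)) *\<^sub>R j)"
proof (rule euclidean_eqI)
  fix b :: "'a \<times> 'b" assume b: "b \<in> Basis"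
  have "(\<Sum>j\<in>Basis. ((if snd j = 0 then c else 1) * (z \<bullet> j)) *\<^sub>R j) \<bullet> b
      = (\<Sum>j\<in>Basis. if j = b then (if snd j = 0 then c else 1) * (z \<bullet> j) else 0)"
    unfolding inner_sum_left by (intro sum.cong) (auto simp: inner_Basis b)
  also have "\<dots> = apfst ((*\<^sub>R) c) z \<bullet> b"
    using b by (auto simp: Basis_prod_def inner_prod_def apfst_def map_prod_def split: prod.splits)
  finally show "apfst ((*\<^sub>R) c) z \<bullet> b = (\<Sum>j\<in>Basis. ((if snd j = 0 then c else 1) * (z \<bullet> j)) *\<^sub>R j) \<bullet> b"
    by simp
qed

lemma prod_Basis_apfst_scale:
  fixes c :: real
  shows "(\<Prod>j\<in>(Basis :: ('a::euclidean_space \<times> 'b::euclidean_space) set). \<bar>if snd j = 0 then c else 1\<bar>)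
     = \<bar>c\<bar> ^ DIM('a)"
proof -
  have inj: "inj_on (\<lambda>u. (u, 0::'b)) Basis" "inj_on (\<lambda>v. (0::'a, v)) Basis"
    by (auto intro: inj_onI)
  have "(\<Prod>j\<in>(Basis :: ('a \<times> 'b) set). \<bar>if snd j = 0 then c else 1\<bar>)
      = (\<Prod>u\<in>(Basis :: 'a set). \<bar>c\<bar>) * (\<Prod>v\<in>(Basis :: 'b set). 1)"
    unfolding Basis_prod_def
    by (subst prod.union_disjoint) (auto simp: prod.reindex[OF inj(1)] prod.reindex[OF inj(2)] nonzero_Basis)
  then show ?thesis by simp
qed

lemma
  fixes c :: real
  assumes "c \<noteq> 0"
  shows lebesgue_apfst_scaleR: "(lebesgue :: ('a::euclidean_space \<times> 'b::euclidean_space) measure)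
      = density (distr lebesgue lebesgue (apfst ((*\<^sub>R) c))) (\<lambda>_. ennreal (\<bar>c\<bar> ^ DIM('a)))"
    and lebesgue_measurable_apfst_scaleR:
      "apfst ((*\<^sub>R) c) \<in> (lebesgue :: ('a \<times> 'b) measure) \<rightarrow>\<^sub>M lebesgue"
  using lebesgue_affine_euclidean[of "\<lambda>j::'a \<times> 'b. if snd j = 0 then c else 1" 0]
    lebesgue_affine_measurable[of "\<lambda>j::'a \<times> 'b. if snd j = 0 then c else 1" 0] assms
  by (simp_all add: apfst_scaleR_eq_sum[abs_def] prod_Basis_apfst_scale)

lemma nn_integral_lebesgue_apfst_scaleR:
  fixes F :: "'a::euclidean_space \<times> 'b::euclidean_space \<Rightarrow> ennreal" and c :: real
  assumes c: "c \<noteq> 0" and F[measurable]: "F \<in> borel_measurable lebesgue"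
  shows "(\<integral>\<^sup>+z. F z \<partial>lebesgue) = ennreal (\<bar>c\<bar> ^ DIM('a)) * (\<integral>\<^sup>+z. F (apfst ((*\<^sub>R) c) z) \<partial>lebesgue)"
proof -
  note T[measurable] = lebesgue_measurable_apfst_scaleR[OF c]
  have "(\<integral>\<^sup>+z. F z \<partial>lebesgue)
      = (\<integral>\<^sup>+z. ennreal (\<bar>c\<bar> ^ DIM('a)) * F z \<partial>distr lebesgue lebesgue (apfst ((*\<^sub>R) c)))"
    by (subst lebesgue_apfst_scaleR[OF c]) (simp add: nn_integral_density)
  also have "\<dots> = (\<integral>\<^sup>+z. ennreal (\<bar>c\<bar> ^ DIM('a)) * F (apfst ((*\<^sub>R) c) z) \<partial>lebesgue)"
    by (simp add: nn_integral_distr)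
  finally show ?thesis by (simp add: nn_integral_cmult)
qed

lemma nn_integral_diff_real:
  assumes [measurable]: "f \<in> borel_measurable M" "g \<in> borel_measurable M"
    and "\<And>x. 0 \<le> g x" "\<And>x. g x \<le> f x"
    and F: "(\<integral>\<^sup>+x. ennreal (f x) \<partial>M) = ennreal F" and G: "(\<integral>\<^sup>+x. ennreal (g x) \<partial>M) = ennreal G"
    and "0 \<le> G"
  shows "(\<integral>\<^sup>+x. ennreal (f x - g x) \<partial>M) = ennreal (F - G)"
proof -
  have "(\<integral>\<^sup>+x. ennreal (f x - g x) \<partial>M) = (\<integral>\<^sup>+x. ennreal (f x) - ennreal (g x) \<partial>M)"
    using assms by (intro nn_integral_cong) (simp add: ennreal_minus)
  also have "\<dots> = ennreal F - ennreal G"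
    unfolding F[symmetric] G[symmetric] using assms
    by (intro nn_integral_diff) (auto intro: ennreal_leI)
  finally show ?thesis
    using \<open>0 \<le> G\<close> by (simp add: ennreal_minus)
qed

lemma norm_orthogonal_matrix_mult:
  fixes A :: "real^'n^'n"
  assumes "orthogonal_matrix A"
  shows "norm (A *v x) = norm x"
  by (metis assms matrix_of_matrix_vector_mul matrix_vector_mul_linear
      orthogonal_transformation_matrix orthogonal_transformation_norm)

section \<open>Mass, metric coefficient and the functional\<close>

lemma mass_on_mono: "S \<subseteq> T \<Longrightarrow> mass_on h S \<le> mass_on h T"
  unfolding mass_on_def by (intro nn_integral_mono) (auto simp: indicator_def)

lemma mass_on_ball_le:
  assumes [measurable]: "h \<in> borel_measurable lebesgue"
    and rho: "\<forall>x. rho h x \<le> ennreal \<sigma>" and "0 \<le> \<sigma>" "0 \<le> r"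
  shows "mass_on h {z. norm (fst z) \<le> r} \<le> ennreal (\<sigma> * (4/3 * pi * r^3))"
proof -
  have "mass_on h {z. norm (fst z) \<le> r} = (\<integral>\<^sup>+x. indicator (cball 0 r) x * rho h x \<partial>lebesgue)"
    unfolding mass_on_def
    by (subst nn_integral_lebesgue_pair) (auto simp: rho_def indicator_def intro!: nn_integral_cong)
  also have "\<dots> \<le> (\<integral>\<^sup>+x. ennreal \<sigma> * indicator (cball (0::real^3) r) x \<partial>lebesgue)"
    using rho by (intro nn_integral_mono) (auto simp: indicator_def)
  also have "\<dots> = ennreal \<sigma> * emeasure lebesgue (cball (0::real^3) r)"
    by (rule nn_integral_cmult_indicator) auto
  also have "emeasure lebesgue (cball (0::real^3) r) = ennreal (4/3 * pi * r^3)"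
    using emeasure_cball[OF \<open>0 \<le> r\<close>, of "0::real^3"] by (simp add: unit_ball_vol_3)
  also have "ennreal \<sigma> * ennreal (4/3 * pi * r^3) = ennreal (\<sigma> * (4/3 * pi * r^3))"
    by (rule ennreal_mult[symmetric]) (use assms in auto)
  finally show ?thesis .
qed

lemma mass_on_inside_add_outside:
  assumes [measurable]: "h \<in> borel_measurable lebesgue"
  shows "mass_on h {z. norm (fst z) \<le> r} + mass_on h {z. r \<le> norm (fst z)} = mass_on h UNIV"
proof -
  have "AE z in lebesgue. z \<notin> {z::phase. norm (fst z) = r}"
    by (rule AE_not_in) (rule null_sets_lebesgue_norm_fst_eq)
  then show ?thesis
    unfolding mass_on_def
    by (subst nn_integral_add[symmetric])
       (auto elim!: eventually_mono intro!: nn_integral_cong_AE simp: indicator_def)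
qed

lemma mass_on_less_top:
  assumes "mass_on h UNIV \<le> ennreal M"
  shows "mass_on h S < top"
  using le_less_trans[OF order_trans[OF mass_on_mono[OF subset_UNIV] assms] ennreal_less_top] .

lemma mass_on_inside_eq:
  assumes "h \<in> borel_measurable lebesgue" "mass_on h UNIV = ennreal M"
  shows "mass_on h {z. norm (fst z) \<le> R} = ennreal (M - enn2real (mass_on h {z. R \<le> norm (fst z)}))"
proof -
  let ?out = "enn2real (mass_on h {z. R \<le> norm (fst z)})"
  have "mass_on h {z. norm (fst z) \<le> R} + ennreal ?out = ennreal M"
    using mass_on_inside_add_outside[OF assms(1), of R] mass_on_less_top[of h M] assms(2) by simp
  then have "mass_on h {z. norm (fst z) \<le> R} = ennreal M - ennreal ?out"
    by (metis ennreal_add_diff_cancel_right ennreal_neq_top)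
  then show ?thesis
    by (simp add: ennreal_minus)
qed

lemma mass_on_ball_eq_m_f:
  assumes "mass_on h UNIV \<le> ennreal M"
  shows "mass_on h {z. norm (fst z) \<le> r} = ennreal (m_f h r)"
proof -
  have "mass_on h {z. norm (fst z) \<le> r} \<le> ennreal M"
    using mass_on_mono[of _ UNIV] assms order_trans by blast
  then show ?thesis
    unfolding m_f_def by (cases "mass_on h {z. norm (fst z) \<le> r}") (auto simp: top_unique)
qed

lemma m_f_nonneg: "0 \<le> m_f h r"
  by (simp add: m_f_def)

lemma m_f_le:
  assumes "mass_on h UNIV \<le> ennreal M" "0 \<le> M"
  shows "m_f h r \<le> M"
  using mass_on_ball_eq_m_f[OF assms(1)] mass_on_mono[of _ UNIV h] assms by (metis ennreal_le_iff order_trans top_greatest)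

lemma m_f_mono:
  assumes "mass_on h UNIV \<le> ennreal M"
  shows "mono (m_f h)"
proof
  fix r s :: real assume "r \<le> s"
  then have "mass_on h {z. norm (fst z) \<le> r} \<le> mass_on h {z. norm (fst z) \<le> s}"
    by (intro mass_on_mono) auto
  then show "m_f h r \<le> m_f h s"
    unfolding mass_on_ball_eq_m_f[OF assms] using m_f_nonneg by (simp add: ennreal_le_iff)
qed

lemma borel_measurable_exp_lam[measurable]:
  assumes "mass_on h UNIV \<le> ennreal M"
  shows "(\<lambda>z::phase. exp (lam h (norm (fst z)))) \<in> borel_measurable lebesgue"
proof -
  have [measurable]: "m_f h \<in> borel_measurable borel"
    using m_f_mono[OF assms] by (rule borel_measurable_mono)
  show ?thesis
    unfolding lam_def by measurable
qed

text \<open>For \<open>r \<ge> M / \<beta>\<close> the total mass suffices, for smaller \<open>r\<close> the density bound.\<close>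

lemma compactness_le_of_mass_le:
  fixes \<beta> M \<sigma> m r :: real
  assumes "0 < \<beta>" "0 < M" "\<sigma> \<le> 3 * \<beta>^3 / (4 * pi * M^2)"
    and "0 \<le> m" "m \<le> M" "m \<le> \<sigma> * (4/3 * pi * r^3)"
  shows "m / r \<le> \<beta>"
proof (cases "M / \<beta> \<le> r")
  case True
  then have "0 < r"
    using divide_pos_pos[OF assms(2,1)] by linarith
  then have "m / r \<le> M / (M / \<beta>)"
    using assms True by (intro frac_le) auto
  then show ?thesis using assms by simp
next
  case False
  show ?thesis
  proof (cases "0 < r")
    case True
    with False have r\<beta>: "r * \<beta> < M" using assms by (simp add: field_simps)
    have "\<sigma> * (4/3 * pi) \<le> 3 * \<beta>^3 / (4 * pi * M^2) * (4/3 * pi)"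
      using assms(3) by (intro mult_right_mono) auto
    also have "\<dots> = \<beta>^3 / M^2"
      by (simp add: field_simps)
    finally have "\<sigma> * (4/3 * pi) * r^3 \<le> \<beta>^3 / M^2 * r^3"
      using True by (intro mult_right_mono) auto
    moreover have "\<sigma> * (4/3 * pi * r^3) = \<sigma> * (4/3 * pi) * r^3"
      by (simp only: mult.assoc)
    ultimately have "m \<le> \<beta>^3 / M^2 * r^3"
      using assms(6) by linarith
    then have "m / r \<le> \<beta> * ((r * \<beta>)^2 / M^2)"
      using True by (simp add: field_simps power2_eq_square power3_eq_cube)
    also have "\<dots> \<le> \<beta>"
      using r\<beta> assms True by (intro mult_left_le) (auto intro!: power_mono)
    finally show ?thesis .
  next
    case False
    then have "m / r \<le> 0"
      using assms(4) by (simp add: divide_nonneg_nonpos)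
    then show ?thesis
      using assms(1) by linarith
  qed
qed

lemma exp_lam:
  assumes "2 * m_f h r / r < 1"
  shows "exp (lam h r) = 1 / sqrt (1 - 2 * m_f h r / r)"
proof -
  have "exp (ln (1 - 2 * m_f h r / r) / 2) = sqrt (1 - 2 * m_f h r / r)"
    using assms by (simp add: exp_divide_power_eq ln_sqrt[symmetric])
  then show ?thesis
    unfolding lam_def by (simp add: exp_minus inverse_eq_divide)
qed

lemma lam_mono:
  assumes "2 * m_f h r / r \<le> 2 * m_f g s / s" "2 * m_f g s / s < 1"
  shows "lam h r \<le> lam g s"
  unfolding lam_def using assms by (simp add: divide_right_mono)

lemma chi_nonneg: "0 < k \<Longrightarrow> 0 \<le> s \<Longrightarrow> 0 \<le> chi k s"
  unfolding chi_def by simp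

lemma chi_zero[simp]: "chi k 0 = 0"
  by (simp add: chi_def)

lemma chi_le_self:
  assumes "0 < k" "0 \<le> s" "s \<le> 1"
  shows "chi k s \<le> s"
proof -
  have "s powr (1 + 1/k) \<le> s powr 1"
    using assms by (intro powr_mono') auto
  moreover have "k / (k + 1) \<le> 1"
    using assms by simp
  ultimately have "k / (k + 1) * s powr (1 + 1/k) \<le> 1 * s"
    using assms by (intro mult_mono) auto
  then show ?thesis
    unfolding chi_def by simp
qed

lemma chi_measurable[measurable]: "chi k \<in> borel_measurable borel"
  unfolding chi_def by measurable

text \<open>The hypotheses under which \<open>\<lambda>\<close> stays bounded and \<open>D\<close> is a finite real.\<close>

definition subadmissible :: "real \<Rightarrow> real \<Rightarrow> (phase \<Rightarrow> real) \<Rightarrow> bool" where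
  "subadmissible M \<sigma> h \<longleftrightarrow> h \<in> borel_measurable lebesgue \<and> (\<forall>z. 0 \<le> h z \<and> h z \<le> 1)
     \<and> mass_on h UNIV \<le> ennreal M \<and> (\<forall>x. rho h x \<le> ennreal \<sigma>)"

lemma subadmissibleD:
  assumes "subadmissible M \<sigma> h"
  shows "h \<in> borel_measurable lebesgue" "0 \<le> h z" "h z \<le> 1" "mass_on h UNIV \<le> ennreal M"
    "rho h x \<le> ennreal \<sigma>"
  using assms unfolding subadmissible_def by blast+

lemma subadmissible_of_admissible:
  "h \<in> admissible m \<sigma> \<Longrightarrow> m \<le> M \<Longrightarrow> \<forall>z. h z \<le> 1 \<Longrightarrow> subadmissible M \<sigma> h"
  unfolding admissible_def subadmissible_def by (auto intro: ennreal_leI)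

text \<open>On subadmissible functions \<open>\<chi>(f) \<le> f\<close>, so \<open>D\<close> is non-positive and \<open>deficit\<close> is \<open>-D\<close>.\<close>

definition deficit :: "real \<Rightarrow> (phase \<Rightarrow> real) \<Rightarrow> real" where
  "deficit k h = enn2real (\<integral>\<^sup>+z. ennreal (exp (lam h (norm (fst z))) * (h z - chi k (h z))) \<partial>lebesgue)"

lemma deficit_nonneg: "0 \<le> deficit k h"
  by (simp add: deficit_def)

section \<open>Cutting off and dilating\<close>

definition cutoff :: "real \<Rightarrow> (phase \<Rightarrow> real) \<Rightarrow> phase \<Rightarrow> real" where
  "cutoff R h = (\<lambda>z. indicator {z. norm (fst z) \<le> R} z * h z)"

lemma measurable_cutoff[measurable]:
  "h \<in> borel_measurable lebesgue \<Longrightarrow> cutoff R h \<in> borel_measurable lebesgue"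
  unfolding cutoff_def by measurable

lemma mass_on_cutoff: "mass_on (cutoff R h) UNIV = mass_on h {z. norm (fst z) \<le> R}"
  unfolding mass_on_def cutoff_def by (intro nn_integral_cong) (auto simp: indicator_def)

lemma m_f_cutoff: "r \<le> R \<Longrightarrow> m_f (cutoff R h) r = m_f h r"
  unfolding m_f_def mass_on_def cutoff_def
  by (intro arg_cong[where f = enn2real] nn_integral_cong) (auto simp: indicator_def)

lemma lam_cutoff: "r \<le> R \<Longrightarrow> lam (cutoff R h) r = lam h r"
  unfolding lam_def by (simp add: m_f_cutoff)

lemma spher_symm_cutoff: "spher_symm h \<Longrightarrow> spher_symm (cutoff R h)"
  unfolding spher_symm_def cutoff_def by (simp add: indicator_def norm_orthogonal_matrix_mult)

lemma rho_cutoff_le: "\<forall>z. 0 \<le> h z \<Longrightarrow> rho (cutoff R h) x \<le> rho h x"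
  unfolding rho_def cutoff_def
  by (intro nn_integral_mono ennreal_leI mult_left_mono) (auto simp: indicator_def)

lemma cutoff_admissible:
  assumes "h \<in> admissible M \<sigma>" "mass_on h {z. norm (fst z) \<le> R} = ennreal m"
  shows "cutoff R h \<in> admissible m \<sigma>"
proof -
  have h: "h \<in> borel_measurable lebesgue" "spher_symm h" "\<forall>z. 0 \<le> h z"
    "\<forall>x. rho h x \<le> ennreal \<sigma>"
    using assms(1) unfolding admissible_def by blast+
  then have "\<forall>x. rho (cutoff R h) x \<le> ennreal \<sigma>"
    using rho_cutoff_le order_trans by blast
  moreover have "\<forall>z. 0 \<le> cutoff R h z"
    using h(3) by (simp add: cutoff_def)
  ultimately show ?thesis
    using h assms(2) by (simp add: admissible_def mass_on_cutoff spher_symm_cutoff)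
qed

lemma subadmissible_cutoff: "subadmissible M \<sigma> h \<Longrightarrow> subadmissible M \<sigma> (cutoff R h)"
  unfolding subadmissible_def mass_on_cutoff
  using rho_cutoff_le[of h R] mass_on_mono[of _ UNIV h] order_trans
  by (auto simp: cutoff_def indicator_def) (blast+)

definition dilate :: "real \<Rightarrow> (phase \<Rightarrow> real) \<Rightarrow> phase \<Rightarrow> real" where
  "dilate a h = (\<lambda>z. h (apfst ((*\<^sub>R) (1 / a)) z))"

lemma dilate_apfst_scaleR: "a \<noteq> 0 \<Longrightarrow> dilate a h (apfst ((*\<^sub>R) a) z) = h z"
  by (simp add: dilate_def apfst_def map_prod_def split: prod.splits)

lemma measurable_dilate:
  assumes "a \<noteq> 0" "h \<in> borel_measurable lebesgue"
  shows "dilate a h \<in> borel_measurable lebesgue"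
  unfolding dilate_def using assms
  by (intro measurable_compose[OF lebesgue_measurable_apfst_scaleR]) simp_all

lemma mass_on_dilate:
  assumes "0 < a" "h \<in> borel_measurable lebesgue" "S \<in> sets lebesgue"
  shows "mass_on (dilate a h) S = ennreal (a^3) * mass_on h (apfst ((*\<^sub>R) a) -` S)"
proof -
  note [measurable] = measurable_dilate[OF _ assms(2)] assms(3)
  show ?thesis
    unfolding mass_on_def using assms
    by (subst nn_integral_lebesgue_apfst_scaleR[of a])
       (simp_all add: dilate_apfst_scaleR indicator_def)
qed

lemma m_f_dilate:
  assumes "0 < a" "h \<in> borel_measurable lebesgue"
  shows "m_f (dilate a h) (a * r) = a^3 * m_f h r"
proof -
  have "apfst ((*\<^sub>R) a) -` {z. norm (fst z) \<le> a * r} = {z::phase. norm (fst z) \<le> r}"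
    using assms(1) by (auto simp: apfst_def map_prod_def split: prod.splits)
  then show ?thesis
    using mass_on_dilate[OF assms, of "{z. norm (fst z) \<le> a * r}"] assms(1)
    by (simp add: m_f_def enn2real_mult)
qed

lemma spher_symm_dilate: "spher_symm h \<Longrightarrow> spher_symm (dilate a h)"
  unfolding spher_symm_def dilate_def by (simp add: matrix_vector_mult_scaleR[symmetric])

lemma dilate_admissible:
  assumes "h \<in> admissible m \<sigma>" "0 < a" "a^3 * m = M"
  shows "dilate a h \<in> admissible M \<sigma>"
proof -
  have h: "h \<in> borel_measurable lebesgue" "spher_symm h" "\<forall>z. 0 \<le> h z"
    "mass_on h UNIV = ennreal m" "\<forall>x. rho h x \<le> ennreal \<sigma>"
    using assms(1) unfolding admissible_def by blast+
  have "mass_on (dilate a h) UNIV = ennreal (a^3) * ennreal m"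
    using mass_on_dilate[OF assms(2) h(1), of UNIV] h(4) by simp
  also have "\<dots> = ennreal M"
    unfolding assms(3)[symmetric] using assms(2) by (simp add: ennreal_mult')
  moreover have "rho (dilate a h) x = rho h ((1 / a) *\<^sub>R x)" for x
    unfolding rho_def dilate_def by simp
  moreover have "dilate a h \<in> borel_measurable lebesgue"
    using assms(2) h(1) by (simp add: measurable_dilate)
  moreover have "\<forall>z. 0 \<le> dilate a h z"
    using h(3) by (simp add: dilate_def)
  ultimately show ?thesis
    using h(2,5) by (simp add: admissible_def spher_symm_dilate)
qed

lemma exp_lam_le_exterior:
  assumes "mass_on h UNIV \<le> ennreal M" "0 \<le> M" "0 < R" "R \<le> r" "0 < C"
    and "2 * M / R \<le> 1 - 1 / C^2"
  shows "exp (lam h r) \<le> C"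
proof -
  have "2 * m_f h r / r \<le> 2 * M / r"
    using m_f_le[OF assms(1,2)] assms(3,4) by (simp add: divide_right_mono)
  also have "\<dots> \<le> 2 * M / R"
    using assms(2-4) by (intro divide_left_mono) auto
  finally have y: "1 / C^2 \<le> 1 - 2 * m_f h r / r"
    using assms(6) by simp
  then have "sqrt (1 / C^2) \<le> sqrt (1 - 2 * m_f h r / r)"
    by (rule real_sqrt_le_mono)
  then have "1 / C \<le> sqrt (1 - 2 * m_f h r / r)"
    using assms(5) by (simp add: real_sqrt_divide)
  moreover have "0 < 1 / C^2"
    using assms(5) by simp
  with y have "2 * m_f h r / r < 1"
    by linarith
  ultimately have "1 / sqrt (1 - 2 * m_f h r / r) \<le> C"
    using assms(5) by (simp add: divide_le_eq mult.commute)
  then show ?thesis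
    using \<open>2 * m_f h r / r < 1\<close> by (simp add: exp_lam)
qed

section \<open>Comparison of deficits\<close>

text \<open>This smallness of \<open>\<sigma>\<close> keeps the compactness \<open>2 m(r) / r\<close> below \<open>2 \<beta> < 1\<close>.\<close>

locale compactness_bound =
  fixes M \<beta> \<sigma> :: real
  assumes M_pos: "0 < M" and \<beta>_pos: "0 < \<beta>" and \<beta>_less: "\<beta> < 1/2" and \<sigma>_pos: "0 < \<sigma>"
    and \<sigma>_le: "\<sigma> \<le> 3 * \<beta>^3 / (4 * pi * M^2)"
begin

lemma compactness_le:
  assumes "subadmissible M \<sigma> h"
  shows "2 * m_f h r / r \<le> 2 * \<beta>"
proof (cases "0 \<le> r")
  case True
  have "m_f h r \<le> \<sigma> * (4/3 * pi * r^3)"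
    using mass_on_ball_le[of h \<sigma> r] mass_on_ball_eq_m_f[of h M r] assms True \<sigma>_pos
    by (auto simp: subadmissible_def)
  then have "m_f h r / r \<le> \<beta>"
    using compactness_le_of_mass_le[OF \<beta>_pos M_pos \<sigma>_le m_f_nonneg] m_f_le[of h M r] assms M_pos
    by (auto simp: subadmissible_def)
  then show ?thesis by simp
next
  case False
  then have "m_f h r / r \<le> 0"
    using m_f_nonneg[of h r] by (simp add: divide_nonneg_neg)
  then show ?thesis
    using \<beta>_pos by simp
qed

lemma exp_lam_le:
  assumes "subadmissible M \<sigma> h"
  shows "exp (lam h r) \<le> 1 / sqrt (1 - 2 * \<beta>)"
proof -
  have "2 * m_f h r / r \<le> 2 * \<beta>"
    using assms by (rule compactness_le)
  moreover have "exp (lam h r) = 1 / sqrt (1 - 2 * m_f h r / r)"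
    using calculation \<beta>_less by (intro exp_lam) simp
  ultimately show ?thesis
    using \<beta>_less by (simp add: frac_le)
qed

lemma nn_integral_exp_lam_finite:
  assumes "subadmissible M \<sigma> h"
  shows "(\<integral>\<^sup>+z. ennreal (exp (lam h (norm (fst z))) * h z) \<partial>lebesgue) < \<infinity>"
proof -
  define B where "B = 1 / sqrt (1 - 2 * \<beta>)"
  note h = subadmissibleD[OF assms]
  note [measurable] = h(1)
  have "h z \<le> sqrt (1 + (norm (snd z))\<^sup>2) * h z" for z
    using mult_right_mono[of 1 "sqrt (1 + (norm (snd z))\<^sup>2)" "h z"] h(2) by simp
  then have "exp (lam h (norm (fst z))) * h z \<le> B * (sqrt (1 + (norm (snd z))\<^sup>2) * h z)" for z
    using exp_lam_le[OF assms] h(2) \<beta>_less by (intro mult_mono) (auto simp: B_def)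
  then have "(\<integral>\<^sup>+z. ennreal (exp (lam h (norm (fst z))) * h z) \<partial>lebesgue) \<le> ennreal B * mass_on h UNIV"
    unfolding mass_on_def using h(2) \<beta>_less
    by (subst nn_integral_cmult[symmetric]) (auto intro!: nn_integral_mono simp: B_def ennreal_mult[symmetric] ennreal_leI)
  also have "\<dots> < \<infinity>"
    using le_less_trans[OF h(4) ennreal_less_top] by (simp add: ennreal_mult_less_top)
  finally show ?thesis .
qed

lemma
  assumes "subadmissible M \<sigma> h" "0 < k"
  shows nn_integral_deficit: "(\<integral>\<^sup>+z. ennreal (exp (lam h (norm (fst z))) * (h z - chi k (h z))) \<partial>lebesgue)
      = ennreal (deficit k h)"
    and D_eq_deficit: "D k h = ereal (- deficit k h)"
proof -
  let ?E = "\<lambda>z. exp (lam h (norm (fst z)))"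
  note h = subadmissibleD[OF assms(1)]
  note [measurable] = h(1) borel_measurable_exp_lam[OF h(4)]
  have chi: "0 \<le> ?E z * chi k (h z)" "?E z * chi k (h z) \<le> ?E z * h z" for z
    using h(2,3)[of z] assms(2) by (auto intro!: mult_left_mono mult_nonneg_nonneg chi_le_self chi_nonneg)
  obtain q where q: "(\<integral>\<^sup>+z. ennreal (?E z * h z) \<partial>lebesgue) = ennreal q" "0 \<le> q"
    using nn_integral_exp_lam_finite[OF assms(1)] by (cases "\<integral>\<^sup>+z. ennreal (?E z * h z) \<partial>lebesgue") auto
  have le: "(\<integral>\<^sup>+z. ennreal (?E z * chi k (h z)) \<partial>lebesgue) \<le> ennreal q"
    unfolding q(1)[symmetric] using chi by (intro nn_integral_mono ennreal_leI) auto
  then obtain p where p: "(\<integral>\<^sup>+z. ennreal (?E z * chi k (h z)) \<partial>lebesgue) = ennreal p" "0 \<le> p"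
    by (cases "\<integral>\<^sup>+z. ennreal (?E z * chi k (h z)) \<partial>lebesgue") (auto simp: top_unique)
  with le q(2) have "p \<le> q"
    by simp
  have "(\<lambda>z. ?E z * h z) \<in> borel_measurable lebesgue"
    by measurable
  moreover have "(\<lambda>z. ?E z * chi k (h z)) \<in> borel_measurable lebesgue"
    by measurable
  ultimately have "(\<integral>\<^sup>+z. ennreal (?E z * h z - ?E z * chi k (h z)) \<partial>lebesgue) = ennreal (q - p)"
    by (rule nn_integral_diff_real[OF _ _ chi q(1) p])
  then have "(\<integral>\<^sup>+z. ennreal (?E z * (h z - chi k (h z))) \<partial>lebesgue) = ennreal (q - p)"
    by (simp add: right_diff_distrib)
  moreover from this have "deficit k h = q - p"
    using \<open>p \<le> q\<close> by (simp add: deficit_def)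
  ultimately show "(\<integral>\<^sup>+z. ennreal (?E z * (h z - chi k (h z))) \<partial>lebesgue) = ennreal (deficit k h)"
    and "D k h = ereal (- deficit k h)"
    using p q by (simp_all add: D_def)
qed

lemma deficit_le_of_near_minimal:
  assumes "0 < k" "subadmissible M \<sigma> f" "D k f \<le> (INF g\<in>admissible M \<sigma>. D k g) + ereal \<epsilon>"
    and "g \<in> admissible M \<sigma>" "\<forall>z. g z \<le> 1"
  shows "deficit k g \<le> deficit k f + \<epsilon>"
proof -
  have "D k f \<le> D k g + ereal \<epsilon>"
    using assms(3) INF_lower[OF assms(4), of "D k"] by (metis add_right_mono order_trans)
  moreover have "subadmissible M \<sigma> g"
    using assms(4) order_refl assms(5) by (rule subadmissible_of_admissible)
  ultimately show ?thesis
    using D_eq_deficit[OF assms(2,1)] D_eq_deficit[OF _ assms(1)] by simp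
qed

lemma lam_le_lam_dilate:
  assumes "1 \<le> a" "h \<in> borel_measurable lebesgue" "subadmissible M \<sigma> (dilate a h)" "0 \<le> r"
  shows "lam h r \<le> lam (dilate a h) (a * r)"
proof (rule lam_mono)
  have "2 * m_f (dilate a h) (a * r) / (a * r) = a^2 * (2 * m_f h r / r)"
    using m_f_dilate[of a h r] assms(1,2) by (simp add: power2_eq_square power3_eq_cube)
  moreover have "1 * (2 * m_f h r / r) \<le> a^2 * (2 * m_f h r / r)"
    using assms(1,4) m_f_nonneg[of h r] by (intro mult_right_mono) (simp_all add: one_le_power)
  ultimately show "2 * m_f h r / r \<le> 2 * m_f (dilate a h) (a * r) / (a * r)"
    by simp
  show "2 * m_f (dilate a h) (a * r) / (a * r) < 1"
    using compactness_le[OF assms(3), of "a * r"] \<beta>_less by linarith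
qed

lemma deficit_le_deficit_dilate:
  assumes "0 < k" "1 \<le> a" "subadmissible M \<sigma> h" "subadmissible M \<sigma> (dilate a h)"
  shows "a^3 * deficit k h \<le> deficit k (dilate a h)"
proof -
  let ?g = "dilate a h" and ?T = "apfst ((*\<^sub>R) a)"
  let ?F = "\<lambda>z. ennreal (exp (lam ?g (norm (fst z))) * (?g z - chi k (?g z)))"
  note h = subadmissibleD[OF assms(3)] and g = subadmissibleD[OF assms(4)]
  note [measurable] = h(1) g(1) borel_measurable_exp_lam[OF g(4)]
  have "exp (lam h (norm (fst z))) * (h z - chi k (h z))
      \<le> exp (lam ?g (norm (fst (?T z)))) * (?g (?T z) - chi k (?g (?T z)))" for z
  proof -
    have "exp (lam h (norm (fst z))) \<le> exp (lam ?g (norm (fst (?T z))))"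
      using lam_le_lam_dilate[OF assms(2) h(1) assms(4) norm_ge_zero] assms(2) by simp
    moreover have "?g (?T z) = h z"
      using assms(2) by (simp add: dilate_apfst_scaleR)
    ultimately show ?thesis
      using chi_le_self[OF assms(1) h(2,3)] by (simp add: mult_right_mono)
  qed
  then have "ennreal (a^3) * ennreal (deficit k h) \<le> ennreal (a^3) * (\<integral>\<^sup>+z. ?F (?T z) \<partial>lebesgue)"
    unfolding nn_integral_deficit[OF assms(3,1), symmetric]
    by (intro mult_left_mono nn_integral_mono ennreal_leI) auto
  also have "\<dots> = integral\<^sup>N lebesgue ?F"
    using nn_integral_lebesgue_apfst_scaleR[of a ?F] assms(2) by simp
  also have "\<dots> = ennreal (deficit k ?g)"
    by (rule nn_integral_deficit[OF assms(4,1)])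
  finally show ?thesis
    using assms(2) by (simp add: ennreal_mult'[symmetric] deficit_def)
qed

lemma deficit_le_deficit_cutoff:
  assumes "0 < k" "subadmissible M \<sigma> h" and exterior: "\<forall>r\<ge>R. exp (lam h r) \<le> C"
  shows "deficit k h \<le> deficit k (cutoff R h) + C * enn2real (mass_on h {z. R \<le> norm (fst z)})"
proof -
  let ?h1 = "cutoff R h" and ?w = "\<lambda>z::phase. sqrt (1 + (norm (snd z))\<^sup>2)"
  note h = subadmissibleD[OF assms(2)] and h1 = subadmissibleD[OF subadmissible_cutoff[OF assms(2)]]
  note [measurable] = h(1) h1(1) borel_measurable_exp_lam[OF h1(4)]
  have "0 \<le> C"
    using exterior[rule_format, of R] exp_ge_zero[of "lam h R"] by linarith
  have pointwise: "ennreal (exp (lam h (norm (fst z))) * (h z - chi k (h z)))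
      \<le> ennreal (exp (lam ?h1 (norm (fst z))) * (?h1 z - chi k (?h1 z)))
        + ennreal C * (indicator {z. R \<le> norm (fst z)} z * ennreal (?w z * h z))" for z
  proof (cases "norm (fst z) \<le> R")
    case True
    then show ?thesis
      unfolding lam_cutoff[OF True] by (simp add: cutoff_def)
  next
    case False
    have "0 \<le> chi k (h z)" "h z \<le> ?w z * h z"
      using chi_nonneg[OF assms(1) h(2)] mult_right_mono[of 1 "?w z" "h z"] h(2)[of z] by simp_all
    then have "h z - chi k (h z) \<le> ?w z * h z"
      by linarith
    then have "exp (lam h (norm (fst z))) * (h z - chi k (h z)) \<le> C * (?w z * h z)"
      using exterior False chi_le_self[OF assms(1) h(2,3)] \<open>0 \<le> C\<close> by (intro mult_mono) auto
    moreover have "cutoff R h z = 0"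
      using False by (simp add: cutoff_def)
    ultimately show ?thesis
      using False \<open>0 \<le> C\<close> h(2)[of z] by (simp add: ennreal_leI ennreal_mult[symmetric])
  qed
  have "ennreal (deficit k h) \<le> (\<integral>\<^sup>+z. ennreal (exp (lam ?h1 (norm (fst z))) * (?h1 z - chi k (?h1 z)))
        + ennreal C * (indicator {z. R \<le> norm (fst z)} z * ennreal (?w z * h z)) \<partial>lebesgue)"
    unfolding nn_integral_deficit[OF assms(2,1), symmetric] by (intro nn_integral_mono pointwise)
  also have "\<dots> = ennreal (deficit k ?h1) + ennreal C * mass_on h {z. R \<le> norm (fst z)}"
  proof -
    have "(\<lambda>z. ennreal (exp (lam ?h1 (norm (fst z))) * (?h1 z - chi k (?h1 z)))) \<in> borel_measurable lebesgue"
      by measurable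
    moreover have "(\<lambda>z. indicator {z. R \<le> norm (fst z)} z * ennreal (?w z * h z)) \<in> borel_measurable lebesgue"
      by measurable
    ultimately show ?thesis
      unfolding mass_on_def nn_integral_deficit[OF subadmissible_cutoff[OF assms(2)] assms(1), symmetric]
      by (simp add: nn_integral_add nn_integral_cmult)
  qed
  also have "mass_on h {z. R \<le> norm (fst z)} = ennreal (enn2real (mass_on h {z. R \<le> norm (fst z)}))"
    using mass_on_less_top[OF h(4)] by simp
  also have "ennreal (deficit k ?h1) + ennreal C * \<dots>
      = ennreal (deficit k ?h1 + C * enn2real (mass_on h {z. R \<le> norm (fst z)}))"
    using \<open>0 \<le> C\<close> by (simp add: ennreal_plus ennreal_mult deficit_def)
  finally have "ennreal (deficit k h)
      \<le> ennreal (deficit k ?h1 + C * enn2real (mass_on h {z. R \<le> norm (fst z)}))" .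
  moreover have "0 \<le> deficit k ?h1 + C * enn2real (mass_on h {z. R \<le> norm (fst z)})"
    using \<open>0 \<le> C\<close> by (simp add: deficit_def)
  ultimately show ?thesis
    by (simp add: ennreal_le_iff)
qed

end

theorem lemma5p2:
  fixes k M \<beta> \<sigma>0 \<epsilon> \<eta> R :: real and f :: "phase \<Rightarrow> real"
  assumes "0 < k" "k \<le> 2" "0 < M" "0 < \<beta>" "\<beta> < 1/2"
    and "0 < \<sigma>0" "\<sigma>0 \<le> min 1 (3 * \<beta>^3 / (4 * pi * M\<^sup>2))"
    and "f \<in> admissible M \<sigma>0"
    and "0 < \<epsilon>" "0 < \<eta>" "0 < R"
    and "2 * M / R \<le> 1 - 1 / (1 + \<eta>)\<^sup>2"
    and "\<forall>z. f z \<le> 1"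
    and "D k f \<le> (INF g\<in>admissible M \<sigma>0. D k g) + ereal \<epsilon>"
    and "0 < enn2real (mass_on f {z. norm (fst z) \<ge> R})"
    and "enn2real (mass_on f {z. norm (fst z) \<ge> R}) < M"
  shows "let \<Delta>M = enn2real (mass_on f {z. norm (fst z) \<ge> R});
             f1 = (\<lambda>z. indicator {z. norm (fst z) \<le> R} z * f z)
         in ereal (\<Delta>M / (M - \<Delta>M)) * \<bar>D k f1\<bar> \<le> ereal ((1 + \<eta>) * \<Delta>M + \<epsilon>)"
proof -
  interpret compactness_bound M \<beta> \<sigma>0
    using assms(3-7) by unfold_locales auto
  define \<Delta>M where "\<Delta>M = enn2real (mass_on f {z. R \<le> norm (fst z)})"
  define m where "m = M - \<Delta>M"
  define a where "a = root 3 (M / m)"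
  define g where "g = dilate a (cutoff R f)"
  have f: "subadmissible M \<sigma>0 f"
    using assms(8) order_refl assms(13) by (rule subadmissible_of_admissible)
  have m_pos: "0 < m" and a1: "1 \<le> a" and a3: "a^3 * m = M"
    using assms(15,16) by (simp_all add: a_def m_def \<Delta>M_def)
  have "mass_on f {z. norm (fst z) \<le> R} = ennreal m"
    using assms(8) by (simp add: mass_on_inside_eq admissible_def m_def \<Delta>M_def)
  then have g_adm: "g \<in> admissible M \<sigma>0"
    unfolding g_def using a1 a3 assms(8) by (intro dilate_admissible cutoff_admissible) auto
  have g_le_1: "\<forall>z. g z \<le> 1"
    using assms(13) by (simp add: g_def dilate_def cutoff_def indicator_def)
  have minimal: "deficit k g \<le> deficit k f + \<epsilon>"
    using assms(1) f assms(14) g_adm g_le_1 by (rule deficit_le_of_near_minimal)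
  have scaling: "a^3 * deficit k (cutoff R f) \<le> deficit k g"
    unfolding g_def using assms(1) a1 subadmissible_cutoff[OF f]
    by (rule deficit_le_deficit_dilate) (use g_adm g_le_1 in \<open>simp add: g_def subadmissible_of_admissible\<close>)
  have "\<forall>r\<ge>R. exp (lam f r) \<le> 1 + \<eta>"
    using exp_lam_le_exterior[OF subadmissibleD(4)[OF f]] assms(3,10-12) by auto
  then have cutting: "deficit k f \<le> deficit k (cutoff R f) + (1 + \<eta>) * \<Delta>M"
    unfolding \<Delta>M_def using assms(1) f by (intro deficit_le_deficit_cutoff)
  have "(a^3 - 1) * deficit k (cutoff R f) \<le> (1 + \<eta>) * \<Delta>M + \<epsilon>"
    using minimal scaling cutting by (simp add: left_diff_distrib)
  moreover have "a^3 - 1 = \<Delta>M / (M - \<Delta>M)"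
    using a3 m_pos by (simp add: m_def field_simps)
  ultimately show ?thesis
    using D_eq_deficit[OF subadmissible_cutoff[OF f] assms(1)] deficit_nonneg[of k "cutoff R f"]
    by (simp add: Let_def \<Delta>M_def cutoff_def[symmetric])
qed

end
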